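(* Let $\mathcal{H}$ be a complex separable Hilbert space and let $\mathcal{M},\mathcal{N}$ be linear subspaces of $\mathcal{H}$. The following conditions are equivalent: (i) $P_{\mathcal{M},\mathcal{N}}$ is decomposable; (ii) $\mathcal{M}+\mathcal{N}=\bigl(\mathcal{M}\cap\overline{\mathcal{M}^{\perp}+\mathcal{N}^{\perp}}\bigr)\dotplus\mathcal{N}$; (iii) $P_{\overline{\mathcal{M}}\cap\overline{\mathcal{N}}}(\mathcal{M})=\mathcal{M}\cap\mathcal{N}$; (iv) $\mathcal{M}=\bigl(\mathcal{M}\cap\overline{\mathcal{M}^{\perp}+\mathcal{N}^{\perp}}\bigr)\oplus(\mathcal{M}\cap\mathcal{N})$. If any of these conditions holds, then $\overline{\mathcal{M}\cap\mathcal{N}}=\overline{\mathcal{M}}\cap\overline{\mathcal{N}}$ and $$P_{\mathcal{M},\mathcal{N}}=P_{\mathcal{M}\cap(\mathcal{M}\cap\mathcal{N})^{\perp},\,\mathcal{N}}\ \hat{\oplus}\ (\{0\}\times(\mathcal{M}\cap\mathcal{N})),$$ where $P_{\mathcal{M}\cap(\mathcal{M}\cap\mathcal{N})^{\perp},\,\mathcal{N}}$ is a projection (i.e. single-valued).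
   Context: A linear relation on $\mathcal{H}$ is a linear subspace $T$ of $\mathcal{H}\times\mathcal{H}$; operators are identified with their graphs. $\operatorname{dom}T$ is the set of first components and $\operatorname{mul}T=\{y:(0,y)\in T\}$. The adjoint is $T^*=\{(x,y):\langle g,x\rangle=\langle f,y\rangle\ \forall(f,g)\in T\}$. For a relation $T$, $T_0:=T\cap(\overline{\operatorname{dom}}\,T\times\overline{\operatorname{dom}}\,T^* )$ (an operator), and $T$ is decomposable if $\operatorname{dom}T_0=\operatorname{dom}T$, equivalently $T=T_0\,\hat{\oplus}\,(\{0\}\times\operatorname{mul}T)$. For subspaces, $\dotplus$ is a direct sum and $\oplus$ an orthogonal direct sum; $\hat{\oplus}$ is the orthogonal sum of subspaces of $\mathcal{H}\times\mathcal{H}$. $P_{\mathcal{M},\mathcal{N}}=\{(m+n,m):m\in\mathcal{M},n\in\mathcal{N}\}$ is the multivalued projection with range $\mathcal{M}$ and kernel $\mathcal{N}$; its multivalued part is $\mathcal{M}\cap\mathcal{N}$. For a closed subspace $\mathcal{S}$, $P_{\mathcal{S}}$ is the orthogonal projection onto $\mathcal{S}$. *)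

theory Defs
  imports "HOL-Analysis.Analysis"
begin

section \<open>Complex Hilbert spaces\<close>

class complex_vector = real_vector +
  fixes scaleC :: "complex \<Rightarrow> 'a \<Rightarrow> 'a"  (infixr "*\<^sub>C" 75)
  assumes scaleC_add_right: "c *\<^sub>C (x + y) = c *\<^sub>C x + c *\<^sub>C y"
    and scaleC_add_left: "(c + d) *\<^sub>C x = c *\<^sub>C x + d *\<^sub>C x"
    and scaleC_scaleC: "c *\<^sub>C (d *\<^sub>C x) = (c * d) *\<^sub>C x"
    and scaleC_one: "1 *\<^sub>C x = x"
    and scaleR_scaleC: "r *\<^sub>R x = complex_of_real r *\<^sub>C x"

interpretation complex_vector:
  vector_space "scaleC :: complex \<Rightarrow> 'a \<Rightarrow> 'a::complex_vector"
  by unfold_locales (fact scaleC_add_right scaleC_add_left scaleC_scaleC scaleC_one)+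

abbreviation csubspace :: "'a::complex_vector set \<Rightarrow> bool"
  where "csubspace \<equiv> complex_vector.subspace"

text \<open>The inner product is linear in its first argument.  Metric and topology come from the norm
  via \<^class>\<open>real_normed_vector\<close>, and the last axiom makes that norm the one induced by the
  inner product.\<close>

class complex_inner = complex_vector + real_normed_vector +
  fixes cinner :: "'a \<Rightarrow> 'a \<Rightarrow> complex"
  assumes cinner_commute: "cinner x y = cnj (cinner y x)"
    and cinner_add_left: "cinner (x + y) z = cinner x z + cinner y z"
    and cinner_scaleC_left: "cinner (c *\<^sub>C x) y = c * cinner x y"
    and norm_eq_sqrt_cinner: "norm x = sqrt (Re (cinner x x))"

class chilbert_space = complex_inner + complete_space

instantiation complex :: chilbert_space
begin
definition scaleC_complex :: "complex \<Rightarrow> complex \<Rightarrow> complex"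
  where "scaleC_complex c x = c * x"
definition cinner_complex :: "complex \<Rightarrow> complex \<Rightarrow> complex"
  where "cinner_complex x y = x * cnj y"
instance
  by standard
    (auto simp: scaleC_complex_def cinner_complex_def algebra_simps scaleR_conv_of_real
      cmod_def power2_eq_square)
end

text \<open>The product of two spaces, with the sum inner product, so that orthogonality in the product
  is an instance of the general notion.\<close>

instantiation prod :: (complex_vector, complex_vector) complex_vector
begin
definition scaleC_prod :: "complex \<Rightarrow> 'a \<times> 'b \<Rightarrow> 'a \<times> 'b"
  where "scaleC_prod c p = (c *\<^sub>C fst p, c *\<^sub>C snd p)"
instance
  by standard
    (auto simp: scaleC_prod_def prod_eq_iff scaleC_add_right scaleC_add_left scaleC_scaleC
      scaleC_one scaleR_scaleC)
end

lemma cinner_self_nonneg: "0 \<le> Re (cinner x x)"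
  for x :: "'a::complex_inner"
  using norm_ge_zero[of x] unfolding norm_eq_sqrt_cinner by simp

instantiation prod :: (complex_inner, complex_inner) complex_inner
begin
definition cinner_prod :: "'a \<times> 'b \<Rightarrow> 'a \<times> 'b \<Rightarrow> complex"
  where "cinner_prod p q = cinner (fst p) (fst q) + cinner (snd p) (snd q)"
instance
proof
  fix x y z :: "'a \<times> 'b" and c :: complex
  show "cinner x y = cnj (cinner y x)"
    unfolding cinner_prod_def using cinner_commute by (metis complex_cnj_add)
  show "cinner (x + y) z = cinner x z + cinner y z"
    by (simp add: cinner_prod_def cinner_add_left)
  show "cinner (c *\<^sub>C x) y = c * cinner x y"
    by (simp add: cinner_prod_def scaleC_prod_def cinner_scaleC_left distrib_left)
  show "norm x = sqrt (Re (cinner x x))"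
    by (simp add: norm_prod_def cinner_prod_def norm_eq_sqrt_cinner cinner_self_nonneg)
qed
end

instance prod :: (chilbert_space, chilbert_space) chilbert_space ..

section \<open>Subspaces\<close>

definition cortho :: "'a::complex_inner set \<Rightarrow> 'a set"
  where "cortho S = {x. \<forall>y\<in>S. cinner x y = 0}"

text \<open>Here \<open>A + B\<close> is the elementwise sum of sets from \<^theory>\<open>HOL-Library.Set_Algebras\<close>.\<close>

definition is_direct_sum :: "'a::complex_vector set \<Rightarrow> 'a set \<Rightarrow> 'a set \<Rightarrow> bool"
  where "is_direct_sum S A B \<longleftrightarrow> S = A + B \<and> A \<inter> B = {0}"

definition is_orthogonal_sum :: "'a::complex_inner set \<Rightarrow> 'a set \<Rightarrow> 'a set \<Rightarrow> bool"
  where "is_orthogonal_sum S A B \<longleftrightarrow> is_direct_sum S A B \<and> (\<forall>a\<in>A. \<forall>b\<in>B. cinner a b = 0)"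

text \<open>Meaningful for closed subspaces \<open>S\<close> of a Hilbert space, where the described point exists and
  is unique.\<close>

definition orth_proj :: "'a::complex_inner set \<Rightarrow> 'a \<Rightarrow> 'a"
  where "orth_proj S x = (THE y. y \<in> S \<and> x - y \<in> cortho S)"

section \<open>Linear relations\<close>

definition rel_adjoint :: "('a::complex_inner \<times> 'a) set \<Rightarrow> ('a \<times> 'a) set"
  where "rel_adjoint T = {(x, y). \<forall>(f, g)\<in>T. cinner g x = cinner f y}"

definition op_part :: "('a::complex_inner \<times> 'a) set \<Rightarrow> ('a \<times> 'a) set"
  where "op_part T = T \<inter> (closure (Domain T) \<times> closure (Domain (rel_adjoint T)))"

definition decomposable :: "('a::complex_inner \<times> 'a) set \<Rightarrow> bool"
  where "decomposable T \<longleftrightarrow> Domain (op_part T) = Domain T"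

definition mv_proj :: "'a::complex_inner set \<Rightarrow> 'a set \<Rightarrow> ('a \<times> 'a) set"
  where "mv_proj M N = {(m + n, m) | m n. m \<in> M \<and> n \<in> N}"

end

theory Submission
  imports Defs
begin

text \<open>Put \<open>K = closure M \<inter> closure N\<close>.  Since \<open>(M\<^sup>\<bottom> + N\<^sup>\<bottom>)\<^sup>\<bottom> = K\<close>, the closure of
  \<open>M\<^sup>\<bottom> + N\<^sup>\<bottom>\<close> is \<open>K\<^sup>\<bottom>\<close>, and it is also the closure of the domain of the adjoint of
  \<open>P\<^bsub>M,N\<^esub>\<close>, because that adjoint is \<open>P\<^bsub>N\<^sup>\<bottom>,M\<^sup>\<bottom>\<^esub>\<close>.  Hence decomposability reads
  \<open>M + N = (M \<inter> K\<^sup>\<bottom>) + N\<close>, and all four conditions say that \<open>M = (M \<inter> K\<^sup>\<bottom>) + (M \<inter> N)\<close>.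
  In that case a vector of \<open>K\<close> orthogonal to \<open>M \<inter> N\<close> is orthogonal to \<open>M\<close>, hence zero, so that
  \<open>M \<inter> N\<close> is dense in \<open>K\<close>.\<close>

section \<open>Inner products\<close>

lemma cinner_add_right: "cinner x (y + z) = cinner x y + cinner x z"
  for x :: "'a::complex_inner"
  by (metis cinner_add_left cinner_commute complex_cnj_add)

lemma cinner_scaleC_right: "cinner x (c *\<^sub>C y) = cnj c * cinner x y"
  for x :: "'a::complex_inner"
  by (metis cinner_scaleC_left cinner_commute complex_cnj_mult)

lemma scaleC_minus_one: "(-1) *\<^sub>C x = - x"
  for x :: "'a::complex_vector"
  using complex_vector.scale_minus_left[of 1 x] by (simp add: scaleC_one)

lemma cinner_minus_left: "cinner (- x) y = - cinner x y"
  for x :: "'a::complex_inner"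
  by (metis cinner_scaleC_left mult_minus1 scaleC_minus_one)

lemma cinner_minus_right: "cinner x (- y) = - cinner x y"
  for x :: "'a::complex_inner"
  by (metis cinner_minus_left cinner_commute complex_cnj_minus)

lemma cinner_diff_left: "cinner (x - y) z = cinner x z - cinner y z"
  for x :: "'a::complex_inner"
  by (metis cinner_add_left cinner_minus_left diff_conv_add_uminus)

lemma cinner_diff_right: "cinner x (y - z) = cinner x y - cinner x z"
  for x :: "'a::complex_inner"
  by (metis cinner_add_right cinner_minus_right diff_conv_add_uminus)

lemma cinner_zero_left [simp]: "cinner 0 y = 0"
  for y :: "'a::complex_inner"
  using cinner_diff_left[of y y y] by simp

lemma cinner_zero_right [simp]: "cinner x 0 = 0"
  for x :: "'a::complex_inner"
  using cinner_diff_right[of x x x] by simp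

lemma cinner_self: "cinner x x = complex_of_real ((norm x)\<^sup>2)"
  for x :: "'a::complex_inner"
proof (rule complex_eqI)
  show "Re (cinner x x) = Re (complex_of_real ((norm x)\<^sup>2))"
    by (simp add: norm_eq_sqrt_cinner cinner_self_nonneg)
  show "Im (cinner x x) = Im (complex_of_real ((norm x)\<^sup>2))"
    using arg_cong[OF cinner_commute[of x x], of Im] by simp
qed

lemma cinner_self_eq_0_iff: "cinner x x = 0 \<longleftrightarrow> x = 0"
  for x :: "'a::complex_inner"
  by (simp add: cinner_self)

text \<open>The norm axioms cover real scalars only; complex homogeneity is recovered by comparing
  squares through \<open>cinner_self\<close>.\<close>

lemma norm_scaleC: "norm (c *\<^sub>C x) = cmod c * norm x"
  for x :: "'a::complex_inner"
proof -
  have "complex_of_real ((norm (c *\<^sub>C x))\<^sup>2) = (c * cnj c) * cinner x x"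
    unfolding cinner_self[symmetric] by (simp add: cinner_scaleC_left cinner_scaleC_right)
  also have "\<dots> = complex_of_real ((cmod c * norm x)\<^sup>2)"
    by (simp add: complex_norm_square[symmetric] cinner_self power_mult_distrib)
  finally have "(norm (c *\<^sub>C x))\<^sup>2 = (cmod c * norm x)\<^sup>2"
    using of_real_eq_iff by blast
  then show ?thesis by (simp add: power2_eq_iff_nonneg)
qed

lemma parallelogram_law:
  "(norm (x + y))\<^sup>2 + (norm (x - y))\<^sup>2 = 2 * (norm x)\<^sup>2 + 2 * (norm y)\<^sup>2"
  for x :: "'a::complex_inner"
proof -
  have "complex_of_real ((norm (x + y))\<^sup>2 + (norm (x - y))\<^sup>2)
      = complex_of_real (2 * (norm x)\<^sup>2 + 2 * (norm y)\<^sup>2)"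
    by (simp add: of_real_add of_real_mult cinner_self[symmetric] cinner_add_left cinner_add_right
        cinner_diff_left cinner_diff_right del: of_real_power)
  then show ?thesis using of_real_eq_iff by blast
qed

text \<open>Pythagoras: the subtracted multiple of \<open>y\<close> is the component of
  \<open>x\<close> along \<open>y\<close>. The exact value yields Cauchy-Schwarz, and in
  \<open>ex_orthogonal_projection\<close> it measures how much closer to a point one gets by moving
  along a direction.\<close>

lemma norm_diff_projection:
  fixes x y :: "'a::complex_inner"
  assumes "y \<noteq> 0"
  shows "(norm (x - (cinner x y / cinner y y) *\<^sub>C y))\<^sup>2 = (norm x)\<^sup>2 - (cmod (cinner x y))\<^sup>2 / (norm y)\<^sup>2"
proof -
  define c where "c = cinner x y / cinner y y"
  have orth: "cinner (x - c *\<^sub>C y) y = 0"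
    using assms by (simp add: c_def cinner_diff_left cinner_scaleC_left cinner_self_eq_0_iff)
  \<comment> \<open>The residual is orthogonal to \<open>y\<close>, so in the second argument it may
    be replaced by \<open>x\<close>.\<close>
  have "complex_of_real ((norm (x - c *\<^sub>C y))\<^sup>2) = cinner (x - c *\<^sub>C y) x"
    unfolding cinner_self[symmetric]
    by (simp add: cinner_diff_right[of _ x] cinner_scaleC_right orth)
  also have "\<dots> = cinner x x - cinner x y * cnj (cinner x y) / cinner y y"
    by (simp add: cinner_diff_left cinner_scaleC_left c_def cinner_commute[symmetric])
  also have "\<dots> = complex_of_real ((norm x)\<^sup>2 - (cmod (cinner x y))\<^sup>2 / (norm y)\<^sup>2)"
    by (simp add: cinner_self complex_norm_square[symmetric])
  finally show ?thesis unfolding c_def using of_real_eq_iff by blast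
qed

lemma cinner_Cauchy_Schwarz: "cmod (cinner x y) \<le> norm x * norm y"
  for x :: "'a::complex_inner"
proof (cases "y = 0")
  case False
  have "0 \<le> (norm x)\<^sup>2 - (cmod (cinner x y))\<^sup>2 / (norm y)\<^sup>2"
    unfolding norm_diff_projection[OF False, symmetric] by simp
  then have "(cmod (cinner x y))\<^sup>2 \<le> (norm x * norm y)\<^sup>2"
    using False by (simp add: field_simps power_mult_distrib)
  then show ?thesis by (rule power2_le_imp_le) simp
qed simp

text \<open>\<open>bounded_linear\<close> is a real notion; here it supplies the continuity that
  makes orthogonal complements closed.\<close>

lemma bounded_linear_cinner_left: "bounded_linear (\<lambda>x. cinner x y)"
  for y :: "'a::complex_inner"
proof (rule bounded_linear_intro[where K = "norm y"])
  fix r :: real and x :: 'a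
  show "cinner (r *\<^sub>R x) y = r *\<^sub>R cinner x y"
    by (simp add: scaleR_scaleC cinner_scaleC_left scaleC_complex_def)
qed (simp_all add: cinner_add_left cinner_Cauchy_Schwarz)

lemma bounded_linear_scaleC: "bounded_linear (\<lambda>x. c *\<^sub>C (x::'a::complex_inner))"
proof (rule bounded_linear_intro[where K = "cmod c"])
  fix r :: real and x :: 'a
  show "c *\<^sub>C (r *\<^sub>R x) = r *\<^sub>R (c *\<^sub>C x)"
    by (simp add: scaleR_scaleC scaleC_scaleC mult.commute)
qed (simp_all add: scaleC_add_right norm_scaleC mult.commute)

section \<open>Subspaces and orthogonal complements\<close>

lemma csubspace_diff: "csubspace S \<Longrightarrow> x \<in> S \<Longrightarrow> y \<in> S \<Longrightarrow> x - y \<in> S"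
  by (fact complex_vector.subspace_diff)

lemma csubspace_imp_subspace:
  assumes "csubspace S"
  shows "subspace S"
  using assms unfolding subspace_def complex_vector.subspace_def by (simp add: scaleR_scaleC)

lemma csubspace_closure:
  fixes S :: "'a::complex_inner set"
  assumes "csubspace S"
  shows "csubspace (closure S)"
proof -
  have "0 \<in> closure S"
    using complex_vector.subspace_0[OF assms] closure_subset by blast
  moreover have "x + y \<in> closure S" if xy: "x \<in> closure S" "y \<in> closure S" for x y
  proof -
    obtain f g where f: "\<And>n. f n \<in> S" "f \<longlonglongrightarrow> x" and g: "\<And>n. g n \<in> S" "g \<longlonglongrightarrow> y"
      using xy unfolding closure_sequential by blast
    have "\<forall>n. f n + g n \<in> S"
      using f g complex_vector.subspace_add[OF assms] by simp
    moreover have "(\<lambda>n. f n + g n) \<longlonglongrightarrow> x + y"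
      using f g by (intro tendsto_add)
    ultimately show ?thesis
      unfolding closure_sequential by (intro exI[of _ "\<lambda>n. f n + g n"] conjI)
  qed
  moreover have "c *\<^sub>C x \<in> closure S" if "x \<in> closure S" for c x
  proof -
    have "c *\<^sub>C x \<in> closure ((\<lambda>x. c *\<^sub>C x) ` S)"
      using closure_bounded_linear_image_subset[OF bounded_linear_scaleC] that by blast
    also have "\<dots> \<subseteq> closure S"
      by (rule closure_mono) (use assms complex_vector.subspace_scale in blast)
    finally show ?thesis .
  qed
  ultimately show ?thesis
    unfolding complex_vector.subspace_def by blast
qed

lemma csubspace_sum:
  assumes "csubspace A" and "csubspace B"
  shows "csubspace (A + B)"
proof -
  have "A + B = {a + b |a b. a \<in> A \<and> b \<in> B}"
    by (auto simp: set_plus_def)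
  then show ?thesis using complex_vector.subspace_sums[OF assms] by simp
qed

lemma cinner_eq_0_commute: "cinner x y = 0 \<longleftrightarrow> cinner y x = 0"
  for x :: "'a::complex_inner"
  by (metis cinner_commute complex_cnj_zero)

lemma csubspace_cortho: "csubspace (cortho S)"
  unfolding complex_vector.subspace_def
  by (simp add: cortho_def cinner_add_left cinner_scaleC_left)

lemma closed_cortho: "closed (cortho S)"
  for S :: "'a::complex_inner set"
proof -
  have "cortho S = (\<Inter>y\<in>S. {x. cinner x y = 0})"
    by (auto simp: cortho_def)
  moreover have "closed {x. cinner x y = 0}" for y :: 'a
    by (intro closed_Collect_eq continuous_on_const linear_continuous_on
        bounded_linear_cinner_left)
  ultimately show ?thesis by (simp add: closed_INT)
qed

lemma cortho_antimono: "A \<subseteq> B \<Longrightarrow> cortho B \<subseteq> cortho A"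
  by (auto simp: cortho_def)

lemma subset_cortho_cortho: "S \<subseteq> cortho (cortho S)"
  by (auto simp: cortho_def cinner_eq_0_commute)

text \<open>The double complement is closed and contains \<open>S\<close>, hence contains
  \<open>closure S\<close>. Taking complements reverses this, and the triple complement contains the
  single one.\<close>

lemma cortho_closure: "cortho (closure S) = cortho S"
proof
  show "cortho (closure S) \<subseteq> cortho S"
    by (rule cortho_antimono) (rule closure_subset)
  have "closure S \<subseteq> cortho (cortho S)"
    by (intro closure_minimal subset_cortho_cortho closed_cortho)
  then have "cortho (cortho (cortho S)) \<subseteq> cortho (closure S)"
    by (rule cortho_antimono)
  then show "cortho S \<subseteq> cortho (closure S)"
    using subset_cortho_cortho by blast
qed

lemma Int_cortho_subset: "S \<inter> cortho S \<subseteq> {0}"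
  by (auto simp: cortho_def cinner_self_eq_0_iff)

lemma cortho_plus:
  assumes "0 \<in> A" and "0 \<in> B"
  shows "cortho (A + B) = cortho A \<inter> cortho B"
proof
  have "A \<subseteq> A + B" and "B \<subseteq> A + B"
    using set_plus_intro[OF _ assms(2)] set_plus_intro[OF assms(1)] by fastforce+
  then show "cortho (A + B) \<subseteq> cortho A \<inter> cortho B"
    using cortho_antimono by blast
  show "cortho A \<inter> cortho B \<subseteq> cortho (A + B)"
    by (auto simp: cortho_def cinner_add_right elim!: set_plus_elim)
qed

section \<open>Orthogonal projections\<close>

text \<open>A minimizing sequence is Cauchy by the parallelogram law, since midpoints of its terms
  stay in \<open>S\<close> and cannot be closer to \<open>x\<close> than the infimum. Completeness
  gives a limit, and closedness keeps it in \<open>S\<close>.\<close>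

lemma closed_csubspace_nearest_point:
  fixes S :: "'a::chilbert_space set" and x :: 'a
  assumes "closed S" and "csubspace S"
  obtains y where "y \<in> S" and "\<And>z. z \<in> S \<Longrightarrow> norm (x - y) \<le> norm (x - z)"
proof -
  define d where "d = infdist x S"
  have ne: "S \<noteq> {}" using assms(2) complex_vector.subspace_0 by blast
  have d_le: "d \<le> norm (x - z)" if "z \<in> S" for z
    using infdist_le[OF that, of x] by (simp add: d_def dist_norm)
  have d0: "0 \<le> d" by (simp add: d_def infdist_nonneg)
  have "\<exists>y\<in>S. norm (x - y) < d + inverse (real (Suc n))" for n
  proof -
    have "bdd_below (dist x ` S)" by (auto intro: bdd_belowI[where m = 0])
    then show ?thesis
      using cINF_less_iff[OF ne, of "dist x" "d + inverse (real (Suc n))"]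
      by (simp add: d_def infdist_notempty[OF ne] dist_norm)
  qed
  then obtain s where sS: "\<And>n. s n \<in> S"
    and s_less: "\<And>n. norm (x - s n) < d + inverse (real (Suc n))"
    by metis
  have lim: "(\<lambda>n. norm (x - s n)) \<longlonglongrightarrow> d"
  proof (rule tendsto_sandwich[where f = "\<lambda>_. d"])
    show "(\<lambda>n. d + inverse (real (Suc n))) \<longlonglongrightarrow> d"
      by (rule LIMSEQ_inverse_real_of_nat_add)
    show "\<forall>\<^sub>F n in sequentially. norm (x - s n) \<le> d + inverse (real (Suc n))"
      by (intro always_eventually allI less_imp_le s_less)
  qed (use d_le sS in auto)
  have close: "(norm (s m - s n))\<^sup>2
      \<le> 2 * ((norm (x - s m))\<^sup>2 - d\<^sup>2) + 2 * ((norm (x - s n))\<^sup>2 - d\<^sup>2)" for m n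
  proof -
    have "(1/2) *\<^sub>R (s m + s n) \<in> S"
      using csubspace_imp_subspace[OF assms(2)] sS by (simp add: subspace_scale subspace_add)
    from d_le[OF this] have "2 * d \<le> norm (2 *\<^sub>R (x - (1/2) *\<^sub>R (s m + s n)))"
      by simp
    \<comment> \<open>Twice the residual of the midpoint is the sum of the two residuals; their
      difference is \<open>s n - s m\<close>, so the parallelogram law turns the lower bound on the
      sum into an upper bound on the difference.\<close>
    also have "2 *\<^sub>R (x - (1/2) *\<^sub>R (s m + s n)) = (x - s m) + (x - s n)"
      by (simp add: scaleR_diff_right scaleR_2)
    finally have "(2 * d)\<^sup>2 \<le> (norm ((x - s m) + (x - s n)))\<^sup>2"
      using d0 by (intro power_mono) auto
    then show ?thesis
      using parallelogram_law[of "x - s m" "x - s n"]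
      by (simp add: power_mult_distrib norm_minus_commute)
  qed
  have "Cauchy s"
  proof (rule CauchyI)
    fix e :: real assume e: "0 < e"
    have "(\<lambda>n. (norm (x - s n))\<^sup>2 - d\<^sup>2) \<longlonglongrightarrow> d\<^sup>2 - d\<^sup>2"
      by (intro tendsto_intros lim)
    \<comment> \<open>The bound in \<open>close\<close> has two such terms, each with factor 2, so a
      quarter of the square of \<open>e\<close> for each adds up to the whole.\<close>
    then have "\<forall>\<^sub>F n in sequentially. (norm (x - s n))\<^sup>2 - d\<^sup>2 < e\<^sup>2 / 4"
      using e by (intro order_tendstoD(2)[of _ "d\<^sup>2 - d\<^sup>2"]) auto
    then obtain k where k: "\<And>n. n \<ge> k \<Longrightarrow> (norm (x - s n))\<^sup>2 - d\<^sup>2 < e\<^sup>2 / 4"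
      by (auto simp: eventually_sequentially)
    have "norm (s m - s n) < e" if "m \<ge> k" "n \<ge> k" for m n
    proof (rule power2_less_imp_less)
      show "(norm (s m - s n))\<^sup>2 < e\<^sup>2"
        using close[of m n] k[OF that(1)] k[OF that(2)] by (simp add: field_simps)
    qed (use e in simp)
    then show "\<exists>k. \<forall>m\<ge>k. \<forall>n\<ge>k. norm (s m - s n) < e" by blast
  qed
  then obtain y where y: "s \<longlonglongrightarrow> y"
    using Cauchy_convergent_iff convergent_def by blast
  have "(\<lambda>n. norm (x - s n)) \<longlonglongrightarrow> norm (x - y)"
    by (intro tendsto_intros y)
  then have "norm (x - y) = d"
    using lim LIMSEQ_unique by blast
  moreover have "y \<in> S"
    using closed_sequentially[OF assms(1) sS y] .
  ultimately show thesis using d_le that by blast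
qed

text \<open>The nearest point works: if its residual were not orthogonal to some \<open>z\<close> in
  \<open>S\<close>, a step along \<open>z\<close> would reduce the distance.\<close>

lemma ex_orthogonal_projection:
  fixes S :: "'a::chilbert_space set"
  assumes "closed S" and "csubspace S"
  shows "\<exists>y\<in>S. x - y \<in> cortho S"
proof -
  obtain y where y: "y \<in> S" and min: "\<And>z. z \<in> S \<Longrightarrow> norm (x - y) \<le> norm (x - z)"
    using closed_csubspace_nearest_point[OF assms, of x] by blast
  have "cinner (x - y) z = 0" if "z \<in> S" for z
  proof (cases "z = 0")
    case False
    \<comment> \<open>The optimal step along \<open>z\<close>: by
      \<open>norm_diff_projection\<close> it lowers the squared distance by exactly the quotient
      that is then forced to be at most zero.\<close>
    define c where "c = cinner (x - y) z / cinner z z"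
    have "y + c *\<^sub>C z \<in> S"
      using assms(2) y that by (simp add: complex_vector.subspace_add complex_vector.subspace_scale)
    then have "(norm (x - y))\<^sup>2 \<le> (norm (x - y - c *\<^sub>C z))\<^sup>2"
      using min by (simp add: diff_diff_eq)
    then have "(cmod (cinner (x - y) z))\<^sup>2 / (norm z)\<^sup>2 \<le> 0"
      unfolding c_def norm_diff_projection[OF False] by simp
    then show ?thesis using False by (simp add: divide_le_0_iff)
  qed simp
  then show ?thesis using y by (auto simp: cortho_def)
qed

text \<open>Two candidates differ by a vector that lies both in \<open>S\<close> and in its
  complement, so the definite description is met by any one candidate.\<close>

lemma orth_proj_eqI:
  assumes "csubspace S" and "y \<in> S" and "x - y \<in> cortho S"
  shows "orth_proj S x = y"
  unfolding orth_proj_def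
proof (rule the_equality)
  fix z assume z: "z \<in> S \<and> x - z \<in> cortho S"
  have "(x - y) - (x - z) \<in> cortho S"
    using assms(3) z csubspace_diff[OF csubspace_cortho] by blast
  moreover have "z - y \<in> S" using assms z by (simp add: csubspace_diff)
  ultimately show "z = y" using Int_cortho_subset[of S] by force
qed (use assms in simp)

lemma orth_proj:
  fixes S :: "'a::chilbert_space set"
  assumes "closed S" and "csubspace S"
  shows orth_proj_mem: "orth_proj S x \<in> S"
    and diff_orth_proj: "x - orth_proj S x \<in> cortho S"
  using ex_orthogonal_projection[OF assms, of x] orth_proj_eqI[OF assms(2)] by auto

text \<open>Project a vector of \<open>K\<close> onto \<open>closure S\<close>: the residual stays
  in \<open>K\<close> and is orthogonal to \<open>S\<close>, hence vanishes. This serves both the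
  double complement theorem and the density of \<open>M \<inter> N\<close>.\<close>

lemma dense_if_Int_cortho_trivial:
  fixes S K :: "'a::chilbert_space set"
  assumes "csubspace S" and "csubspace K" and "closure S \<subseteq> K" and "K \<inter> cortho S \<subseteq> {0}"
  shows "closure S = K"
proof
  show "K \<subseteq> closure S"
  proof
    fix x assume x: "x \<in> K"
    obtain y where y: "y \<in> closure S" "x - y \<in> cortho S"
      using ex_orthogonal_projection[OF closed_closure csubspace_closure[OF assms(1)], of x]
      by (auto simp: cortho_closure)
    then have "x - y \<in> K" using x assms(2,3) csubspace_diff by blast
    then show "x \<in> closure S" using y assms(4) by force
  qed
qed (fact assms(3))

lemma cortho_cortho:
  fixes S :: "'a::chilbert_space set"
  assumes "csubspace S"
  shows "cortho (cortho S) = closure S"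
proof (rule sym, rule dense_if_Int_cortho_trivial[OF assms csubspace_cortho])
  show "closure S \<subseteq> cortho (cortho S)"
    by (intro closure_minimal subset_cortho_cortho closed_cortho)
  show "cortho (cortho S) \<inter> cortho S \<subseteq> {0}"
    using Int_cortho_subset[of "cortho S"] by blast
qed

text \<open>One complement turns the sum into the intersection of the double complements of
  \<open>M\<close> and \<open>N\<close>; a second complement recovers the closure of the
  sum.\<close>

lemma closure_cortho_plus_cortho:
  fixes M N :: "'a::chilbert_space set"
  assumes "csubspace M" and "csubspace N"
  shows "closure (cortho M + cortho N) = cortho (closure M \<inter> closure N)"
proof -
  have "cortho (cortho M + cortho N) = closure M \<inter> closure N"
    using cortho_plus[of "cortho M" "cortho N"] complex_vector.subspace_0[OF csubspace_cortho]
      cortho_cortho assms by blast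
  then show ?thesis
    using cortho_cortho[OF csubspace_sum[OF csubspace_cortho csubspace_cortho], of M N] by simp
qed

section \<open>Multivalued projections\<close>

lemma mv_proj_iff: "(x, y) \<in> mv_proj M N \<longleftrightarrow> y \<in> M \<and> x - y \<in> N"
  unfolding mv_proj_def by (auto intro!: exI[of _ "x - y"])

lemma Domain_mv_proj: "Domain (mv_proj M N) = M + N"
  unfolding mv_proj_def set_plus_def by auto

text \<open>The defining identity of the adjoint splits when tested on pairs with
  \<open>m = 0\<close> and with \<open>n = 0\<close>: the former puts the value in
  \<open>cortho N\<close>, the latter puts the remainder in \<open>cortho M\<close>.\<close>

lemma rel_adjoint_mv_proj:
  assumes "0 \<in> M" and "0 \<in> N"
  shows "rel_adjoint (mv_proj M N) = mv_proj (cortho N) (cortho M)"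
proof -
  have "(\<forall>m\<in>M. \<forall>n\<in>N. cinner m x = cinner (m + n) y)
      \<longleftrightarrow> (\<forall>n\<in>N. cinner n y = 0) \<and> (\<forall>m\<in>M. cinner m (x - y) = 0)" (is "?L \<longleftrightarrow> ?R") for x y
  proof
    assume L: ?L
    have "cinner n y = 0" if "n \<in> N" for n
      using L assms(1) that by fastforce
    moreover have "cinner m x = cinner m y" if "m \<in> M" for m
      using L assms(2) that by force
    ultimately show ?R by (simp add: cinner_diff_right)
  qed (simp add: cinner_add_left cinner_diff_right)
  moreover have "(x, y) \<in> rel_adjoint (mv_proj M N)
      \<longleftrightarrow> (\<forall>m\<in>M. \<forall>n\<in>N. cinner m x = cinner (m + n) y)" for x y
    unfolding rel_adjoint_def mv_proj_def by blast
  moreover have "(x, y) \<in> mv_proj (cortho N) (cortho M)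
      \<longleftrightarrow> (\<forall>n\<in>N. cinner n y = 0) \<and> (\<forall>m\<in>M. cinner m (x - y) = 0)" for x y
    unfolding mv_proj_iff cortho_def mem_Collect_eq using cinner_eq_0_commute by blast
  ultimately show ?thesis by (simp add: set_eq_iff)
qed

text \<open>First components already lie in the domain, so \<open>op_part\<close> only restricts the
  values to the closure of the adjoint's domain. The result is again a \<open>mv_proj\<close>, with
  its range cut down.\<close>

lemma Domain_op_part_mv_proj:
  assumes "0 \<in> M" and "0 \<in> N"
  shows "Domain (op_part (mv_proj M N)) = (M \<inter> closure (cortho M + cortho N)) + N"
proof -
  have "Domain (rel_adjoint (mv_proj M N)) = cortho M + cortho N"
    by (simp add: rel_adjoint_mv_proj[OF assms] Domain_mv_proj add.commute)
  then have "op_part (mv_proj M N) = mv_proj (M \<inter> closure (cortho M + cortho N)) N"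
    using closure_subset[of "Domain (mv_proj M N)"]
    by (fastforce simp: op_part_def mv_proj_iff)
  then show ?thesis by (simp add: Domain_mv_proj)
qed

text \<open>Two values at one point differ by a vector of \<open>M\<close> that is also a difference
  of kernel components, hence in \<open>N\<close>.\<close>

lemma single_valued_mv_proj:
  assumes "csubspace M" and "csubspace N" and "M \<inter> N \<subseteq> {0}"
  shows "single_valued (mv_proj M N)"
proof (rule single_valuedI)
  fix x y z assume "(x, y) \<in> mv_proj M N" and "(x, z) \<in> mv_proj M N"
  then have "y - z \<in> M" and "(x - z) - (x - y) \<in> N"
    unfolding mv_proj_iff using csubspace_diff assms(1,2) by blast+
  then show "y = z" using assms(3) by auto
qed

text \<open>Splitting a value as \<open>a + b\<close> moves \<open>b\<close> into the multivalued
  part. In the product inner product the zero first component contributes nothing, so orthogonality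
  comes down to that of \<open>A\<close> and \<open>M \<inter> N\<close>.\<close>

lemma is_orthogonal_sum_mv_proj:
  assumes "csubspace M" and "csubspace N"
    and sum: "M = A + (M \<inter> N)" and orth: "A \<subseteq> cortho (M \<inter> N)"
    and "csubspace A"
  shows "is_orthogonal_sum (mv_proj M N) (mv_proj A N) ({0} \<times> (M \<inter> N))"
proof -
  have AM: "A \<subseteq> M"
    using assms complex_vector.subspace_0 by (metis Int_iff add.right_neutral set_plus_intro subsetI)
  have AN: "A \<inter> (M \<inter> N) \<subseteq> {0}"
    using orth Int_cortho_subset by blast
  have "(x, y) \<in> mv_proj M N \<longleftrightarrow> (x, y) \<in> mv_proj A N + {0} \<times> (M \<inter> N)" for x y
  proof
    assume "(x, y) \<in> mv_proj M N"
    then have y: "y \<in> M" "x - y \<in> N" by (auto simp: mv_proj_iff)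
    then obtain a b where ab: "y = a + b" "a \<in> A" "b \<in> M \<inter> N"
      using sum by (metis set_plus_elim)
    \<comment> \<open>This vector is \<open>x - a\<close>, the kernel component once
      \<open>b\<close> has been removed from the value.\<close>
    have "(x - y) + b \<in> N" using y ab assms(2) complex_vector.subspace_add by blast
    then have "(x, a) \<in> mv_proj A N" using ab by (simp add: mv_proj_iff)
    then have "(x, a) + (0, b) \<in> mv_proj A N + {0} \<times> (M \<inter> N)"
      using ab by (intro set_plus_intro) auto
    then show "(x, y) \<in> mv_proj A N + {0} \<times> (M \<inter> N)" using ab by simp
  next
    assume "(x, y) \<in> mv_proj A N + {0} \<times> (M \<inter> N)"
    then obtain a b where ab: "(x, a) \<in> mv_proj A N" "b \<in> M \<inter> N" "y = a + b"
      by (auto elim!: set_plus_elim)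
    then have "x - a \<in> N" and "a \<in> M"
      using AM by (auto simp: mv_proj_iff)
    then have "(x - a) - b \<in> N" and "a + b \<in> M"
      using ab(2) csubspace_diff[OF assms(2)] complex_vector.subspace_add[OF assms(1)] by blast+
    then show "(x, y) \<in> mv_proj M N" using ab by (simp add: mv_proj_iff diff_diff_eq)
  qed
  then have "p \<in> mv_proj M N \<longleftrightarrow> p \<in> mv_proj A N + {0} \<times> (M \<inter> N)" for p
    by (cases p) (simp only:)
  then have "mv_proj M N = mv_proj A N + {0} \<times> (M \<inter> N)"
    by (rule set_eqI)
  moreover have "mv_proj A N \<inter> {0} \<times> (M \<inter> N) = {0}"
    using AN assms(1,2,5) complex_vector.subspace_0
    by (auto simp: mv_proj_iff zero_prod_def)
  moreover have "cinner p q = 0" if "p \<in> mv_proj A N" and "q \<in> {0} \<times> (M \<inter> N)" for p q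
    using that orth by (cases p) (auto simp: mv_proj_iff cinner_prod_def cortho_def)
  ultimately show ?thesis
    unfolding is_orthogonal_sum_def is_direct_sum_def by (intro conjI ballI)
qed

section \<open>Decomposability\<close>

theorem proposition4p2:
  fixes M N :: "'h::chilbert_space set"
  assumes "separable_space (euclidean :: 'h topology)"
    and "csubspace M" and "csubspace N"
  shows "let c1 = decomposable (mv_proj M N);
             c2 = is_direct_sum (M + N) (M \<inter> closure (cortho M + cortho N)) N;
             c3 = (orth_proj (closure M \<inter> closure N) ` M = M \<inter> N);
             c4 = is_orthogonal_sum M (M \<inter> closure (cortho M + cortho N)) (M \<inter> N)
         in (c1 \<longleftrightarrow> c2) \<and> (c2 \<longleftrightarrow> c3) \<and> (c3 \<longleftrightarrow> c4) \<and>
            (c1 \<or> c2 \<or> c3 \<or> c4 \<longrightarrow>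
              closure (M \<inter> N) = closure M \<inter> closure N \<and>
              is_orthogonal_sum (mv_proj M N)
                (mv_proj (M \<inter> cortho (M \<inter> N)) N) ({0} \<times> (M \<inter> N)) \<and>
              single_valued (mv_proj (M \<inter> cortho (M \<inter> N)) N))"
proof -
  note MN = assms(2,3)
  define K where "K = closure M \<inter> closure N"
  \<comment> \<open>By \<open>A_eq\<close> below, this is the first summand in conditions (ii) and
    (iv).\<close>
  define A where "A = M \<inter> cortho K"
  have M0: "0 \<in> M" and N0: "0 \<in> N"
    using MN complex_vector.subspace_0 by auto
  have MN': "csubspace (M \<inter> N)"
    using MN by (rule complex_vector.subspace_inter)
  have K: "csubspace K" "closed K"
    using MN by (auto simp: K_def complex_vector.subspace_inter csubspace_closure)
  have A: "csubspace A"
    using MN by (simp add: A_def complex_vector.subspace_inter csubspace_cortho)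
  have A_eq: "M \<inter> closure (cortho M + cortho N) = A"
    using MN by (simp add: A_def K_def closure_cortho_plus_cortho)
  have MNK: "M \<inter> N \<subseteq> K"
    using closure_subset by (auto simp: K_def)
  have A_orth: "A \<subseteq> cortho (M \<inter> N)"
    using cortho_antimono[OF MNK] by (auto simp: A_def)
  have AN: "A \<inter> (M \<inter> N) = {0}"
    using A_orth Int_cortho_subset[of "M \<inter> N"] M0 N0 complex_vector.subspace_0[OF A] by blast
  have AN': "A \<inter> N = {0}"
    using AN by (auto simp: A_def)
  have sum_subset: "A + (M \<inter> N) \<subseteq> M"
    using complex_vector.subspace_add[OF MN(1)] by (auto simp: A_def elim!: set_plus_elim)
  have c1: "decomposable (mv_proj M N) \<longleftrightarrow> M = A + (M \<inter> N)"
  proof -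
    \<comment> \<open>A modular law argument: forward, writing \<open>m = a + n\<close> forces
      \<open>n = m - a\<close> into \<open>M\<close>, as \<open>A\<close> is contained in
      \<open>M\<close>; backward, \<open>M \<inter> N\<close> is absorbed by
      \<open>N\<close>.\<close>
    have "A + N = M + N \<longleftrightarrow> M = A + (M \<inter> N)"
    proof
      assume eq: "A + N = M + N"
      show "M = A + (M \<inter> N)"
      proof
        show "M \<subseteq> A + (M \<inter> N)"
        proof
          fix m assume m: "m \<in> M"
          then have "m + 0 \<in> A + N" unfolding eq using N0 by (rule set_plus_intro)
          then obtain a n where an: "m = a + n" "a \<in> A" "n \<in> N"
            by (auto elim: set_plus_elim)
          then have "m - a \<in> M" using csubspace_diff[OF MN(1) m, of a] by (simp add: A_def)
          then show "m \<in> A + (M \<inter> N)" using an by auto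
        qed
      qed (fact sum_subset)
    next
      assume eq: "M = A + (M \<inter> N)"
      have "(M \<inter> N) + N = N"
      proof
        show "(M \<inter> N) + N \<subseteq> N"
          using complex_vector.subspace_add[OF MN(2)] by (auto elim!: set_plus_elim)
        show "N \<subseteq> (M \<inter> N) + N"
          using set_plus_intro[of 0 "M \<inter> N" _ N] M0 N0 by auto
      qed
      then show "A + N = M + N" by (metis add.assoc eq)
    qed
    then show ?thesis
      by (simp add: decomposable_def Domain_op_part_mv_proj M0 N0 A_eq Domain_mv_proj)
  qed
  \<comment> \<open>With \<open>AN'\<close> at hand, (ii) reduces to \<open>M + N = A + N\<close>,
    the equality of the two domains.\<close>
  have c2: "is_direct_sum (M + N) A N \<longleftrightarrow> decomposable (mv_proj M N)"
    by (auto simp: is_direct_sum_def decomposable_def Domain_op_part_mv_proj M0 N0 A_eq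
        Domain_mv_proj AN')
  have c4: "is_orthogonal_sum M A (M \<inter> N) \<longleftrightarrow> M = A + (M \<inter> N)"
    using A_orth AN by (auto simp: is_orthogonal_sum_def is_direct_sum_def cortho_def)
  \<comment> \<open>The projection onto \<open>K\<close> realizes the splitting: if it maps
    \<open>M\<close> into \<open>M \<inter> N\<close>, the residual lies in \<open>A\<close>;
    conversely, in \<open>m = a + b\<close> the part \<open>b\<close> lies in \<open>K\<close> and
    \<open>a\<close> is orthogonal to \<open>K\<close>, so \<open>b\<close> is the projection of
    \<open>m\<close>.\<close>
  have c3: "orth_proj K ` M = M \<inter> N \<longleftrightarrow> M = A + (M \<inter> N)"
  proof
    assume eq: "orth_proj K ` M = M \<inter> N"
    show "M = A + (M \<inter> N)"
    proof
      show "M \<subseteq> A + (M \<inter> N)"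
      proof
        fix m assume m: "m \<in> M"
        then have p: "orth_proj K m \<in> M \<inter> N" using eq by blast
        then have "m - orth_proj K m \<in> A"
          using m MN diff_orth_proj[OF K(2,1)] by (simp add: A_def csubspace_diff)
        from set_plus_intro[OF this p] show "m \<in> A + (M \<inter> N)" by simp
      qed
    qed (fact sum_subset)
  next
    assume eq: "M = A + (M \<inter> N)"
    show "orth_proj K ` M = M \<inter> N"
    proof
      show "orth_proj K ` M \<subseteq> M \<inter> N"
      proof
        fix p assume "p \<in> orth_proj K ` M"
        then obtain m where m: "m \<in> M" "p = orth_proj K m" by blast
        then obtain a b where ab: "m = a + b" "a \<in> A" "b \<in> M \<inter> N"
          using eq by (metis set_plus_elim)
        then have "orth_proj K m = b"
          using MNK by (intro orth_proj_eqI K) (auto simp: A_def)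
        then show "p \<in> M \<inter> N" using m ab by simp
      qed
      show "M \<inter> N \<subseteq> orth_proj K ` M"
      proof
        fix b assume b: "b \<in> M \<inter> N"
        then have "orth_proj K b = b"
          using MNK complex_vector.subspace_0[OF csubspace_cortho]
          by (intro orth_proj_eqI K) auto
        then show "b \<in> orth_proj K ` M" using b by force
      qed
    qed
  qed
  have consequences: "closure (M \<inter> N) = K \<and>
      is_orthogonal_sum (mv_proj M N)
        (mv_proj (M \<inter> cortho (M \<inter> N)) N) ({0} \<times> (M \<inter> N)) \<and>
      single_valued (mv_proj (M \<inter> cortho (M \<inter> N)) N)"
    if eq: "M = A + (M \<inter> N)"
  proof -
    have dense: "closure (M \<inter> N) = K"
    proof (rule dense_if_Int_cortho_trivial[OF MN' K(1)])
      show "closure (M \<inter> N) \<subseteq> K" using MNK K(2) by (rule closure_minimal)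
      show "K \<inter> cortho (M \<inter> N) \<subseteq> {0}"
      proof
        fix x assume x: "x \<in> K \<inter> cortho (M \<inter> N)"
        \<comment> \<open>As a vector of \<open>K\<close>, \<open>x\<close> is orthogonal to
          \<open>A\<close>. Being orthogonal to \<open>M \<inter> N\<close> too, it is orthogonal to
          all of \<open>M\<close>, yet it lies in \<open>closure M\<close>.\<close>
        have "x \<in> cortho A"
          using x subset_cortho_cortho[of K] cortho_antimono[of A "cortho K"]
          by (auto simp: A_def)
        then have "x \<in> cortho (A + (M \<inter> N))"
          using x M0 N0 complex_vector.subspace_0[OF A] by (simp add: cortho_plus)
        then have "x \<in> cortho (closure M)" using eq by (simp add: cortho_closure)
        then show "x \<in> {0}" using x Int_cortho_subset[of "closure M"] by (auto simp: K_def)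
      qed
    qed
    \<comment> \<open>Density makes the complements of \<open>M \<inter> N\<close> and
      \<open>K\<close> equal, so the range in the claimed decomposition is \<open>A\<close>.\<close>
    have "M \<inter> cortho (M \<inter> N) = A"
      by (simp add: A_def dense[symmetric] cortho_closure)
    then show ?thesis
      using dense is_orthogonal_sum_mv_proj[OF MN eq A_orth A]
        single_valued_mv_proj[OF A MN(2)] AN' by simp
  qed
  show ?thesis
    unfolding Let_def A_eq K_def[symmetric] using c1 c2 c3 c4 consequences by blast
qed

end
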